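(* Let $M\ge 0$ be an integer, $a=(a_1,\dots,a_M)$ with all $a_i>0$, $\Re(w)>0$ and $k\in\{1,2,3,\dots\}$. Then $$\Gamma_M(kw\,|\,a)=k^{-B_{M,M}(kw\,|\,a)/M!}\prod_{p_1,\dots,p_M=0}^{k-1}\Gamma_M\Bigl(w+\frac{\sum_{j=1}^M p_ja_j}{k}\,\Big|\,a\Bigr).$$
   Context: Barnes multiple gamma function (Ruijsenaars normalization): for $a=(a_1,\dots,a_M)$, $a_j>0$, the Barnes zeta function is $\zeta_M(s,w\,|\,a)=\sum_{k_1,\dots,k_M=0}^\infty (w+k_1a_1+\cdots+k_Ma_M)^{-s}$ for $\Re(s)>M$, $\Re(w)>0$. It continues meromorphically to $s\in\mathbb{C}$ with simple poles only at $s=1,\dots,M$. Set $L_M(w\,|\,a)=\partial_s\zeta_M(s,w\,|\,a)|_{s=0}$ and $\Gamma_M(w\,|\,a)=\exp(L_M(w\,|\,a))$ for $\Re(w)>0$; for $M=0$, $\Gamma_0(w)=1/w$. Multiple Bernoulli polynomials: $B_{M,m}(x\,|\,a)=\frac{d^m}{dt^m}\Big|_{t=0}\Big[t^M\prod_{j=1}^M(1-e^{-a_jt})^{-1}e^{-xt}\Big]$. *)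

theory Defs
  imports "HOL-Complex_Analysis.Complex_Analysis"
begin

(* The parameters (a_1, ..., a_M) are the values of a :: nat => real on {1..M}; values of a
   outside {1..M} are never used. *)

definition barnes_series :: "nat \<Rightarrow> (nat \<Rightarrow> real) \<Rightarrow> complex \<Rightarrow> complex \<Rightarrow> complex" where
  "barnes_series M a s w =
     (\<Sum>\<^sub>\<infinity>n\<in>({1..M} \<rightarrow>\<^sub>E (UNIV :: nat set)).
        (w + (\<Sum>j=1..M. of_nat (n j) * of_real (a j))) powr (-s))"

(* The meromorphic continuation in s to the whole plane. "Nicely meromorphic" fixes the value 0
   at poles and excludes removable singularities, so that the continuation is unique as a total
   function. *)
definition barnes_zeta :: "nat \<Rightarrow> (nat \<Rightarrow> real) \<Rightarrow> complex \<Rightarrow> complex \<Rightarrow> complex" where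
  "barnes_zeta M a s w =
     (THE f. f nicely_meromorphic_on UNIV \<and>
             (\<forall>z. Re z > real M \<longrightarrow> f z = barnes_series M a z w)) s"

definition barnes_L :: "nat \<Rightarrow> (nat \<Rightarrow> real) \<Rightarrow> complex \<Rightarrow> complex" where
  "barnes_L M a w = deriv (\<lambda>s. barnes_zeta M a s w) 0"

definition barnes_Gamma :: "nat \<Rightarrow> (nat \<Rightarrow> real) \<Rightarrow> complex \<Rightarrow> complex" where
  "barnes_Gamma M a w = (if M = 0 then 1 / w else exp (barnes_L M a w))"

(* The generating function has a removable singularity at t = 0 when M > 0, where the plain
   HOL expression evaluates to 0; hence remove_sings. *)
definition multi_bernoulli :: "nat \<Rightarrow> nat \<Rightarrow> (nat \<Rightarrow> real) \<Rightarrow> complex \<Rightarrow> complex" where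
  "multi_bernoulli M m a x =
     (deriv ^^ m)
       (remove_sings (\<lambda>t. t ^ M * (\<Prod>j=1..M. inverse (1 - exp (- of_real (a j) * t))) * exp (- x * t)))
       0"

end

theory Submission imports Defs begin

text \<open>
  For \<open>Re s > M\<close>, sorting the lattice points \<open>n\<close> by their residues \<open>p\<close> modulo \<open>k\<close> gives
  \<open>\<zeta>(s, kw) = k\<^sup>-\<^sup>s \<Sum>\<^sub>p \<zeta>(s, w + (p, a) / k)\<close>, where \<open>(p, a) = \<Sum>\<^sub>j p\<^sub>j a\<^sub>j\<close>. This
  persists under continuation in \<open>s\<close>, and the derivative at \<open>s = 0\<close> is the logarithm of the claim once
  one knows \<open>\<zeta>(0, w) = B\<^sub>M\<^sub>,\<^sub>M(w) / M!\<close>.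

  Both the continuation and this value are obtained without a Mellin transform. Let \<open>\<Delta>\<close> be the product
  of the difference operators \<open>h(w) \<mapsto> h(w) - h(w + a\<^sub>j)\<close>, that is \<open>\<Prod>\<^sub>j (1 - exp(-a\<^sub>j t))\<close> with
  \<open>t = -d/dw\<close>. Truncating the Laurent series of \<open>1 / \<Prod>\<^sub>j (1 - exp(-a\<^sub>j t))\<close> at order \<open>N\<close> and applying
  it to \<open>w\<^sup>-\<^sup>s\<close> gives a finite combination \<open>G\<close> of powers of \<open>w\<close> such that
  \<open>\<Delta> G - w\<^sup>-\<^sup>s\<close> decays like \<open>|w|\<close> to the power \<open>M - Re s - N - 1\<close>. Since \<open>\<Delta>\<close> telescopes over the lattice,
  \<open>\<zeta>(s, w)\<close> equals \<open>G(w)\<close> minus the lattice sum of the error terms, which converges for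
  \<open>Re s > 2M - N - 1\<close>. At \<open>s = 0\<close> the error vanishes identically and \<open>G\<close> is \<open>B\<^sub>M\<^sub>,\<^sub>M / M!\<close>.
\<close>

subsection \<open>Preliminaries\<close>

text \<open>Both \<open>w\<close> and \<open>1 + x / w\<close> lie in the right half-plane, so their
  arguments sum to less than pi in absolute value and the principal logarithm needs no branch
  correction.\<close>

lemma powr_add_of_real:
  fixes w z :: complex
  assumes "Re w > 0" "x \<ge> 0" "x < norm w"
  shows "(w + of_real x) powr z = w powr z * (1 + of_real x / w) powr z"
proof -
  have w: "w \<noteq> 0" using assms by auto
  define u where "u = 1 + of_real x / w"
  have "Re (of_real x / w) \<ge> 0"
    using assms by (simp add: Re_divide)
  then have u: "Re u > 0" by (simp add: u_def)
  then have u0: "u \<noteq> 0" by fastforce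
  have eq: "w + of_real x = w * u" using w by (simp add: u_def field_simps)
  have "\<bar>Im (Ln w)\<bar> < pi/2" "\<bar>Im (Ln u)\<bar> < pi/2"
    using assms(1) u w u0 Re_Ln_pos_lt by blast+
  then have "Ln (w * u) = Ln w + Ln u"
    using w u0 by (intro Ln_times_simple) auto
  then show ?thesis
    unfolding eq u_def[symmetric] using w u0 by (simp add: powr_def exp_add distrib_left)
qed

lemma norm_powr_le:
  fixes w z :: complex
  assumes "w \<noteq> 0"
  shows "norm (w powr z) \<le> norm w powr Re z * exp (pi * \<bar>Im z\<bar>)"
proof -
  have "\<bar>Im z * Im (Ln w)\<bar> \<le> \<bar>Im z\<bar> * pi"
    unfolding abs_mult
    using mpi_less_Im_Ln[OF assms] Im_Ln_le_pi[OF assms] by (intro mult_left_mono) auto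
  then have "- (Im z * Im (Ln w)) \<le> pi * \<bar>Im z\<bar>" by (simp add: mult.commute)
  then show ?thesis
    using assms by (simp add: powr_def exp_add[symmetric])
qed

text \<open>Weierstrass M-test with a local majorant. The majorant is only required on the part of
  the ball inside \<open>S\<close>, so callers need not fit the ball into \<open>S\<close>.\<close>

lemma holomorphic_infsum:
  fixes f :: "'a \<Rightarrow> complex \<Rightarrow> complex"
  assumes S: "open S" and hol: "\<And>n. n \<in> X \<Longrightarrow> f n holomorphic_on S"
    and bd: "\<And>s. s \<in> S \<Longrightarrow> \<exists>r>0. \<exists>g. g summable_on X \<and>
                  (\<forall>n\<in>X. \<forall>t\<in>S \<inter> cball s r. norm (f n t) \<le> g n)"
  shows "(\<lambda>s. \<Sum>\<^sub>\<infinity>n\<in>X. f n s) holomorphic_on S"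
proof -
  have "\<exists>r>0. (\<lambda>s. \<Sum>\<^sub>\<infinity>n\<in>X. f n s) holomorphic_on ball s r" if s: "s \<in> S" for s
  proof -
    obtain r g where r: "r > 0" and g: "g summable_on X"
      and le: "\<And>n t. n \<in> X \<Longrightarrow> t \<in> S \<inter> cball s r \<Longrightarrow> norm (f n t) \<le> g n"
      using bd[OF s] by blast
    obtain e where e: "e > 0" "cball s e \<subseteq> S" using S s by (meson open_contains_cball)
    define d where "d = min r e"
    have d: "d > 0" "cball s d \<subseteq> S" "cball s d \<subseteq> cball s r"
      using r e by (auto simp: d_def)
    have "uniform_limit (cball s d) (\<lambda>X t. \<Sum>n\<in>X. f n t) (\<lambda>t. \<Sum>\<^sub>\<infinity>n\<in>X. f n t)
            (finite_subsets_at_top X)"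
      by (rule Weierstrass_m_test_general[OF _ g]) (use d le in blast)
    moreover have "\<forall>\<^sub>F Y in finite_subsets_at_top X. continuous_on (cball s d) (\<lambda>t. \<Sum>n\<in>Y. f n t)
            \<and> (\<lambda>t. \<Sum>n\<in>Y. f n t) holomorphic_on ball s d"
    proof (rule eventually_finite_subsets_at_top_weakI)
      fix Y assume "finite Y" "Y \<subseteq> X"
      then have "(\<lambda>t. \<Sum>n\<in>Y. f n t) holomorphic_on S"
        using hol by (intro holomorphic_intros) auto
      then show "continuous_on (cball s d) (\<lambda>t. \<Sum>n\<in>Y. f n t)
            \<and> (\<lambda>t. \<Sum>n\<in>Y. f n t) holomorphic_on ball s d"
        using d by (meson ball_subset_cball holomorphic_on_imp_continuous_on holomorphic_on_subset)
    qed
    ultimately have "(\<lambda>t. \<Sum>\<^sub>\<infinity>n\<in>X. f n t) holomorphic_on ball s d"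
      using holomorphic_uniform_limit[of s d "\<lambda>X t. \<Sum>n\<in>X. f n t" "finite_subsets_at_top X"
          "\<lambda>t. \<Sum>\<^sub>\<infinity>n\<in>X. f n t"] by (metis (no_types, lifting) finite_subsets_at_top_neq_bot)
    then show ?thesis using d by blast
  qed
  then have "(\<lambda>s. \<Sum>\<^sub>\<infinity>n\<in>X. f n s) analytic_on S"
    by (auto simp: analytic_on_def)
  then show ?thesis by (rule analytic_imp_holomorphic)
qed

text \<open>Expand the product of the factors \<open>-1 + 1\<close> over \<open>A\<close>. This is
  the inclusion-exclusion identity behind the telescoping in \<open>diffop_has_sum\<close>.\<close>

lemma sum_Pow_minus_one:
  assumes "finite A"
  shows "(\<Sum>S\<in>Pow A. (-1) ^ card S) = (if A = {} then 1 else 0 :: 'a :: comm_ring_1)"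
proof -
  have "(\<Sum>S\<in>Pow A. (-1) ^ card S) = (\<Prod>x\<in>A. (-1 :: 'a) + 1)"
    by (subst prod_add[OF assms]) simp
  then show ?thesis using assms by (auto simp: power_0_left)
qed

lemma holomorphic_on_pochhammer [holomorphic_intros]:
  "f holomorphic_on S \<Longrightarrow> (\<lambda>z. pochhammer (f z) n) holomorphic_on S"
  by (induction n) (auto simp: pochhammer_Suc intro!: holomorphic_intros)

lemma continuous_on_pochhammer' [continuous_intros]:
  fixes f :: "'a :: topological_space \<Rightarrow> complex"
  shows "continuous_on S f \<Longrightarrow> continuous_on S (\<lambda>z. pochhammer (f z) n)"
  by (induction n) (auto simp: pochhammer_Suc intro!: continuous_intros)

lemma norm_pochhammer_le:
  fixes z :: complex
  assumes "norm z \<le> Z"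
  shows "norm (pochhammer z n) \<le> pochhammer Z n"
proof (induction n)
  case (Suc n)
  have "norm (z + of_nat n) \<le> Z + of_nat n"
    using assms norm_triangle_ineq[of z "of_nat n"] by simp
  then show ?case
    using Suc by (simp add: pochhammer_Suc norm_mult mult_mono')
qed simp

subsection \<open>Bernoulli polynomials as power series coefficients\<close>

locale barnes =
  fixes M :: nat and a :: "nat \<Rightarrow> real"
  assumes pos: "\<And>j. j \<in> {1..M} \<Longrightarrow> a j > 0"
begin

text \<open>The Taylor series of the product of \<open>t / (1 - exp (- a j * t))\<close>. The shift
  divides by \<open>t\<close>, leaving the nonzero constant term \<open>a j\<close>, so that each
  factor is invertible.\<close>

definition bern_fps :: "complex fps" where
  "bern_fps = (\<Prod>j=1..M. inverse (fps_shift 1 (1 - fps_exp (- of_real (a j)))))"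

lemma bern_fps_times_prod:
  "bern_fps * (\<Prod>j=1..M. 1 - fps_exp (- of_real (a j))) = fps_X ^ M"
proof -
  have *: "inverse (fps_shift 1 (1 - fps_exp (- of_real (a j)))) * (1 - fps_exp (- of_real (a j)))
          = (fps_X :: complex fps)" if j: "j \<in> {1..M}" for j
  proof -
    let ?F = "1 - fps_exp (- of_real (a j)) :: complex fps"
    have F: "?F = fps_shift 1 ?F * fps_X"
      by (rule fps_ext) (auto simp: fps_mult_fps_X_commute)
    have "fps_nth (fps_shift 1 ?F) 0 \<noteq> 0" using pos[OF j] by simp
    then have "inverse (fps_shift 1 ?F) * fps_shift 1 ?F = 1"
      by (rule inverse_mult_eq_1)
    then show ?thesis
      by (subst (2) F) (simp add: mult.assoc[symmetric])
  qed
  show ?thesis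
    unfolding bern_fps_def prod.distrib[symmetric]
    by (subst prod.cong[OF refl *]) auto
qed

text \<open>With \<open>t = -d/dw\<close>, the series \<open>exp (- x * t)\<close> is translation by
  \<open>x\<close>; hence the right-hand side is the symbol of \<open>diffop\<close>.\<close>

lemma prod_one_minus_fps_exp:
  "(\<Prod>j=1..M. 1 - fps_exp (- of_real (a j))) =
   (\<Sum>S\<in>Pow {1..M}. (-1) ^ card S * fps_exp (- of_real (sum a S)) :: complex fps)"
proof -
  have e: "(\<Prod>j\<in>S. fps_exp (- of_real (a j))) = (fps_exp (- of_real (sum a S)) :: complex fps)"
    if "finite S" for S
    using that by induction (auto simp: fps_exp_add_mult[symmetric])
  have "(\<Prod>j=1..M. 1 - fps_exp (- of_real (a j))) =
        (\<Prod>j=1..M. (- fps_exp (- of_real (a j))) + (1 :: complex fps))" by simp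
  also have "\<dots> = (\<Sum>S\<in>Pow {1..M}. (\<Prod>j\<in>S. - fps_exp (- of_real (a j))))"
    by (subst prod_add) auto
  also have "\<dots> = (\<Sum>S\<in>Pow {1..M}. (-1) ^ card S * fps_exp (- of_real (sum a S)))"
  proof (rule sum.cong[OF refl])
    fix S assume "S \<in> Pow {1..M}"
    then have "finite S" by (auto intro: finite_subset)
    then show "(\<Prod>j\<in>S. - fps_exp (- of_real (a j))) = (-1) ^ card S * (fps_exp (- of_real (sum a S)) :: complex fps)"
      by (subst e[symmetric]) (auto simp: prod_uminus)
  qed
  finally show ?thesis .
qed

lemma multi_bernoulli_eq:
  "multi_bernoulli M m a x = fact m * fps_nth (bern_fps * fps_exp (- x)) m"
proof -
  \<comment> \<open>The power \<open>t ^ M\<close> is distributed over the \<open>M\<close> factors,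
    and each resulting factor gets its limit at 0. This turns \<open>?f\<close> into a function
    \<open>h\<close> that is analytic at 0.\<close>
  let ?f = "\<lambda>t. t ^ M * (\<Prod>j=1..M. inverse (1 - exp (- of_real (a j) * t))) * exp (- x * t)"
  let ?g = "\<lambda>j (t::complex). if t = 0 then of_real (a j) else (1 - exp (- of_real (a j) * t)) / t ^ 1"
  define h where "h = (\<lambda>t. (\<Prod>j=1..M. inverse (?g j t)) * exp (- x * t))"
  have h: "h has_fps_expansion bern_fps * fps_exp (- x)"
    unfolding h_def bern_fps_def
  proof (intro has_fps_expansion_mult has_fps_expansion_prod has_fps_expansion_inverse has_fps_expansion_exp)
    fix j assume j: "j \<in> {1..M}"
    show "?g j has_fps_expansion fps_shift 1 (1 - fps_exp (- of_real (a j)))"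
    proof (rule has_fps_expansion_shift)
      show "1 \<le> subdegree (1 - fps_exp (- of_real (a j)) :: complex fps)"
      proof (rule subdegree_geI)
        have "fps_nth (1 - fps_exp (- of_real (a j)) :: complex fps) 1 \<noteq> 0" using pos[OF j] by simp
        then show "1 - fps_exp (- of_real (a j)) \<noteq> (0 :: complex fps)" by (metis fps_zero_nth)
      qed auto
      show "(\<lambda>t. 1 - exp (- of_real (a j) * t)) has_fps_expansion 1 - fps_exp (- complex_of_real (a j))"
        by (intro fps_expansion_intros)
    qed auto
    show "fps_nth (fps_shift 1 (1 - fps_exp (- of_real (a j)) :: complex fps)) 0 \<noteq> 0"
      using pos[OF j] by simp
  qed
  \<comment> \<open>This also covers the nonzero poles: there both sides contain
    \<open>inverse 0 = 0\<close>.\<close>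
  have eq: "?f t = h t" if "t \<noteq> 0" for t
  proof -
    have "(\<Prod>j=1..M. inverse (?g j t)) = (\<Prod>j=1..M. t * inverse (1 - exp (- of_real (a j) * t)))"
      using that by (intro prod.cong) (auto simp: field_simps)
    then show ?thesis by (simp add: h_def prod.distrib)
  qed
  have an: "h analytic_on {0}" using h by (rule has_fps_expansion_imp_analytic_0)
  have ev: "\<forall>\<^sub>F t in at z. ?f t = h t" for z
  proof -
    have "\<forall>\<^sub>F t in at z. t \<noteq> 0" 
      by (cases "z = 0") (auto simp: eventually_neq_at_within)
    then show ?thesis by eventually_elim (rule eq)
  qed
  have "remove_sings ?f = remove_sings h"
    by (rule ext, rule remove_sings_cong[OF ev refl])
  moreover have "\<forall>\<^sub>F t in nhds 0. remove_sings h t = h t"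
    using an by (rule eventually_remove_sings_eq_nhds)
  ultimately have "(deriv ^^ m) (remove_sings ?f) 0 = (deriv ^^ m) h 0"
    by (intro higher_deriv_cong_ev) auto
  also have "\<dots> = fact m * fps_nth (bern_fps * fps_exp (- x)) m"
    using fps_nth_fps_expansion[OF h, of m] by simp
  finally show ?thesis by (simp add: multi_bernoulli_def)
qed

end

subsection \<open>The difference equation and its error term\<close>

text \<open>Since \<open>(-d/dw)^m\<close> maps \<open>w powr (-z)\<close> to
  \<open>pochhammer z m * w powr (-z - m)\<close>, this is translation by \<open>y\<close> written
  in powers of \<open>u = 1 / w\<close>. Reindexing by \<open>l = n + m\<close> pulls out the factor
  \<open>pochhammer z l\<close>, independent of \<open>m\<close>, so the remaining coefficients
  multiply like formal power series.\<close>

lemma binomial_series_shift: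
  fixes y u :: complex
  assumes "norm (y * u) < 1"
  shows "(\<lambda>l. if m \<le> l then pochhammer z l * fps_nth (fps_exp (- y)) (l - m) * u ^ l else 0) sums
           (pochhammer z m * u ^ m * (1 + y * u) powr (- z - of_nat m))"
proof -
  have "(\<lambda>n. ((- z - of_nat m) gchoose n) * (y * u) ^ n) sums (1 + y * u) powr (- z - of_nat m)"
    by (rule gen_binomial_complex[OF assms])
  then have "(\<lambda>n. pochhammer z m * u ^ m * (((- z - of_nat m) gchoose n) * (y * u) ^ n)) sums
     (pochhammer z m * u ^ m * (1 + y * u) powr (- z - of_nat m))"
    by (rule sums_mult)
  moreover have "pochhammer z m * u ^ m * (((- z - of_nat m) gchoose n) * (y * u) ^ n) =
      pochhammer z (n + m) * fps_nth (fps_exp (- y)) n * u ^ (n + m)" for n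
  proof -
    have "(- z - of_nat m) gchoose n = (-1) ^ n * pochhammer (z + of_nat m) n / fact n"
      by (subst gbinomial_pochhammer) (simp add: add.commute)
    moreover have "pochhammer z (n + m) = pochhammer z m * pochhammer (z + of_nat m) n"
      by (subst add.commute, rule pochhammer_product')
    ultimately show ?thesis
      by (simp add: power_add power_mult_distrib power_minus[of y] mult_ac)
  qed
  ultimately have "(\<lambda>n. (\<lambda>l. if m \<le> l then pochhammer z l * fps_nth (fps_exp (- y)) (l - m) * u ^ l else 0) (n + m)) sums
     (pochhammer z m * u ^ m * (1 + y * u) powr (- z - of_nat m))"
    by simp
  then show ?thesis
    by (subst (asm) sums_zero_iff_shift) auto
qed

text \<open>The preceding expansion at \<open>- y\<close>, with \<open>Z\<close> and
  \<open>r\<close> for \<open>z\<close> and \<open>u\<close>, has only nonnegative terms.\<close>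

lemma summable_binomial_majorant:
  fixes y r Z :: real
  assumes "0 \<le> y" "0 \<le> r" "y * r < 1" "0 \<le> Z"
  shows "summable (\<lambda>l. if m \<le> l then pochhammer Z l * (y ^ (l - m) / fact (l - m)) * r ^ l else 0)"
proof -
  have "norm (of_real (- y) * of_real r :: complex) < 1" using assms by (simp add: norm_mult)
  from binomial_series_shift[OF this, of m "of_real Z"]
  have "summable (\<lambda>l. if m \<le> l then pochhammer (of_real Z) l * fps_nth (fps_exp (- of_real (- y))) (l - m) * of_real r ^ l else 0 :: complex)"
    by (rule sums_summable)
  also have "(\<lambda>l. if m \<le> l then pochhammer (of_real Z) l * fps_nth (fps_exp (- of_real (- y))) (l - m) * of_real r ^ l else 0 :: complex) =
     (\<lambda>l. of_real (if m \<le> l then pochhammer Z l * (y ^ (l - m) / fact (l - m)) * r ^ l else 0))"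
    by (auto simp: fun_eq_iff pochhammer_of_real)
  finally show ?thesis by (simp only: summable_complex_of_real)
qed

context barnes begin

definition lat :: "(nat \<Rightarrow> nat) \<Rightarrow> complex" where
  "lat n = (\<Sum>j=1..M. of_nat (n j) * of_real (a j))"

definition diffop :: "(complex \<Rightarrow> complex) \<Rightarrow> complex \<Rightarrow> complex" where
  "diffop h w = (\<Sum>S\<in>Pow {1..M}. (-1) ^ card S * h (w + of_real (sum a S)))"

text \<open>
  With \<open>z = s - M\<close>, \<open>approx N z\<close> and \<open>rmd N z\<close> are the function \<open>G\<close> and its error term, both multiplied
  by \<open>pochhammer (s - M) M = (s - 1) \<cdots> (s - M)\<close> to clear the poles.
\<close>

definition approx :: "nat \<Rightarrow> complex \<Rightarrow> complex \<Rightarrow> complex" where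
  "approx N z w = (\<Sum>m\<le>N. fps_nth bern_fps m * pochhammer z m * w powr (- z - of_nat m))"

definition rmd :: "nat \<Rightarrow> complex \<Rightarrow> complex \<Rightarrow> complex" where
  "rmd N z w = diffop (approx N z) w - pochhammer z M * w powr (- z - of_nat M)"

text \<open>The coefficient of \<open>t ^ l\<close> in the product of \<open>bern_fps\<close>,
  truncated at degree \<open>N\<close>, with all the \<open>1 - exp (- a j * t)\<close>.\<close>

definition dcoeff :: "nat \<Rightarrow> nat \<Rightarrow> complex" where
  "dcoeff N l = (\<Sum>S\<in>Pow {1..M}. (-1) ^ card S *
     (\<Sum>m\<le>N. if m \<le> l then fps_nth bern_fps m * fps_nth (fps_exp (- of_real (sum a S))) (l - m) else 0))"

text \<open>Up to degree \<open>N\<close> the truncation is invisible, and the full product is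
  \<open>fps_X ^ M\<close>.\<close>

lemma dcoeff_eq:
  assumes "l \<le> N"
  shows "dcoeff N l = (if l = M then 1 else 0)"
proof -
  have "(if l = M then 1 else 0) = fps_nth (bern_fps * (\<Sum>S\<in>Pow {1..M}. (-1) ^ card S * fps_exp (- of_real (sum a S)))) l"
    by (simp only: prod_one_minus_fps_exp[symmetric] bern_fps_times_prod fps_X_power_nth)
  also have "\<dots> = (\<Sum>S\<in>Pow {1..M}. fps_nth (fps_const ((-1) ^ card S) * (bern_fps * fps_exp (- of_real (sum a S)))) l)"
    by (simp add: sum_distrib_left fps_sum_nth fps_const_power[symmetric] fps_const_neg[symmetric] mult_ac del: fps_const_neg fps_const_power)
  also have "\<dots> = (\<Sum>S\<in>Pow {1..M}. (-1) ^ card S * (\<Sum>m=0..l. fps_nth bern_fps m * fps_nth (fps_exp (- of_real (sum a S))) (l - m)))"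
    by (intro sum.cong refl, subst fps_mult_left_const_nth, subst fps_mult_nth, rule refl)
  also have "\<dots> = dcoeff N l"
    unfolding dcoeff_def using assms
    by (intro sum.cong refl arg_cong2[where f = "(*)"] sum.mono_neutral_cong_left) auto
  finally show ?thesis by simp
qed

lemma sum_subset:
  assumes "S \<in> Pow {1..M}"
  shows "0 \<le> sum a S" "sum a S \<le> sum a {1..M}"
  using assms pos by (auto intro!: sum_nonneg sum_mono2 simp: less_imp_le subset_iff)

text \<open>Every translate is expanded in powers of \<open>1 / w\<close>, which converges because
  \<open>w\<close> exceeds all shifts in modulus. The factor \<open>w powr z\<close> removes the
  common non-integral power.\<close>

lemma diffop_approx_sums:
  assumes "Re w > 0" "norm w > sum a {1..M}"
  shows "(\<lambda>l. pochhammer z l * dcoeff N l * (1 / w) ^ l) sums (w powr z * diffop (approx N z) w)"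
proof -
  have w: "w \<noteq> 0" using assms by auto
  let ?g = "\<lambda>S m l. if m \<le> l then pochhammer z l * fps_nth (fps_exp (- of_real (sum a S))) (l - m) * (1 / w) ^ l else 0"
  have 1: "(\<lambda>l. (-1) ^ card S * (\<Sum>m\<le>N. fps_nth bern_fps m * ?g S m l)) sums
      (w powr z * ((-1) ^ card S * approx N z (w + of_real (sum a S))))" if S: "S \<in> Pow {1..M}" for S
  proof -
    have x: "0 \<le> sum a S" "sum a S < norm w" using sum_subset[OF S] assms by auto
    have "norm (of_real (sum a S) * (1 / w)) < 1"
      using x w by (simp add: norm_divide del: of_real_sum)
    then have *: "?g S m sums (pochhammer z m * (1 / w) ^ m * (1 + of_real (sum a S) * (1 / w)) powr (- z - of_nat m))" for m
      by (rule binomial_series_shift)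
    have eq: "pochhammer z m * (1 / w) ^ m * (1 + of_real (sum a S) * (1 / w)) powr (- z - of_nat m)
        = w powr z * (pochhammer z m * (w + of_real (sum a S)) powr (- z - of_nat m))" for m
    proof -
      have "(1 / w) ^ m = w powr z * w powr (- z - of_nat m)"
        using w by (simp add: powr_add[symmetric] powr_minus powr_nat' power_one_over inverse_eq_divide)
      then show ?thesis
        using powr_add_of_real[OF assms(1) x] by (simp add: mult_ac del: of_real_sum)
    qed
    have "(\<lambda>l. (-1) ^ card S * (\<Sum>m\<le>N. fps_nth bern_fps m * ?g S m l)) sums
      ((-1) ^ card S * (\<Sum>m\<le>N. fps_nth bern_fps m * (w powr z * (pochhammer z m * (w + of_real (sum a S)) powr (- z - of_nat m)))))"
      using * unfolding eq by (intro sums_mult sums_sum)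
    then show ?thesis
      by (simp add: approx_def sum_distrib_left mult_ac del: of_real_sum)
  qed
  have "(\<lambda>l. \<Sum>S\<in>Pow {1..M}. (-1) ^ card S * (\<Sum>m\<le>N. fps_nth bern_fps m * ?g S m l)) sums
      (\<Sum>S\<in>Pow {1..M}. w powr z * ((-1) ^ card S * approx N z (w + of_real (sum a S))))"
    using 1 by (rule sums_sum)
  moreover have "(\<Sum>S\<in>Pow {1..M}. (-1) ^ card S * (\<Sum>m\<le>N. fps_nth bern_fps m * ?g S m l)) =
      pochhammer z l * dcoeff N l * (1 / w) ^ l" for l
    unfolding dcoeff_def sum_distrib_left sum_distrib_right
    by (intro sum.cong refl) (auto simp: mult_ac)
  ultimately show ?thesis
    by (simp add: diffop_def sum_distrib_left)
qed

text \<open>Among the terms of degree at most \<open>N\<close> only \<open>l = M\<close> survives,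
  and it is exactly the power subtracted in \<open>rmd\<close>. The error is therefore the tail from
  degree \<open>N + 1\<close> on.\<close>

lemma rmd_sums:
  assumes "Re w > 0" "norm w > sum a {1..M}" "M \<le> N"
  shows "(\<lambda>l. pochhammer z (l + Suc N) * dcoeff N (l + Suc N) * (1 / w) ^ (l + Suc N)) sums (w powr z * rmd N z w)"
proof -
  have w: "w \<noteq> 0" using assms by auto
  have "(\<Sum>l<Suc N. pochhammer z l * dcoeff N l * (1 / w) ^ l) =
        (\<Sum>l<Suc N. if l = M then pochhammer z M * (1 / w) ^ M else 0)"
    by (intro sum.cong) (auto simp: dcoeff_eq)
  also have "\<dots> = pochhammer z M * (1 / w) ^ M"
    using assms by simp
  also have "\<dots> = w powr z * (pochhammer z M * w powr (- z - of_nat M))"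
    using w by (simp add: powr_diff powr_minus powr_nat' power_one_over field_simps)
  finally have "(\<Sum>l<Suc N. pochhammer z l * dcoeff N l * (1 / w) ^ l) = w powr z * (pochhammer z M * w powr (- z - of_nat M))" .
  with sums_split_initial_segment[OF diffop_approx_sums[OF assms(1,2), of z N], of "Suc N"]
  show ?thesis by (simp only: rmd_def right_diff_distrib)
qed

lemma rmd_bound_large:
  fixes Z :: real
  assumes "M \<le> N" "Z \<ge> 0"
  obtains B where "B \<ge> 0" and "\<And>z w. norm z \<le> Z \<Longrightarrow> Re w > 0 \<Longrightarrow> norm w \<ge> sum a {1..M} + 1 \<Longrightarrow>
     norm (w powr z * rmd N z w) \<le> B / norm w ^ Suc N"
proof -
  define A where "A = sum a {1..M} + 1"
  have A: "A \<ge> 1" using sum_subset(1)[of "{1..M}"] by (simp add: A_def)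
  \<comment> \<open>As \<open>A\<close> exceeds every \<open>sum a S\<close>, the majorant series
    converges at radius \<open>r\<close>. For \<open>norm w >= A\<close>, each tail term gains a
    further factor \<open>(A / norm w) ^ Suc N\<close>.\<close>
  define r where "r = 1 / A"
  define D where "D l = (\<Sum>S\<in>Pow {1..M}. \<Sum>m\<le>N.
     if m \<le> l then norm (fps_nth bern_fps m) * (sum a S ^ (l - m) / fact (l - m)) else 0)" for l
  have r: "r > 0" using A by (simp add: r_def)
  have D: "norm (dcoeff N l) \<le> D l" for l
    unfolding dcoeff_def D_def
  proof (intro sum_norm_le)
    fix S assume S: "S \<in> Pow {1..M}"
    show "norm ((-1) ^ card S * (\<Sum>m\<le>N. if m \<le> l then fps_nth bern_fps m * fps_nth (fps_exp (- of_real (sum a S))) (l - m) else 0))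
      \<le> (\<Sum>m\<le>N. if m \<le> l then norm (fps_nth bern_fps m) * (sum a S ^ (l - m) / fact (l - m)) else 0)"
      unfolding norm_mult norm_power using sum_subset(1)[OF S]
      by (auto intro!: sum_norm_le simp: norm_mult norm_divide norm_power simp del: of_real_sum)
  qed
  have D0: "D l \<ge> 0" for l using D[of l] norm_ge_zero order_trans by blast
  have "summable (\<lambda>l. \<Sum>S\<in>Pow {1..M}. \<Sum>m\<le>N. norm (fps_nth bern_fps m) *
     (if m \<le> l then pochhammer Z l * (sum a S ^ (l - m) / fact (l - m)) * r ^ l else 0))"
  proof (intro summable_sum summable_mult summable_binomial_majorant)
    fix S assume S: "S \<in> Pow {1..M}"
    show "sum a S * r < 1" using sum_subset[OF S] A by (simp add: r_def A_def)
  qed (use sum_subset assms r in auto)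
  moreover have "(\<Sum>S\<in>Pow {1..M}. \<Sum>m\<le>N. norm (fps_nth bern_fps m) *
     (if m \<le> l then pochhammer Z l * (sum a S ^ (l - m) / fact (l - m)) * r ^ l else 0)) = pochhammer Z l * D l * r ^ l" for l
    unfolding D_def sum_distrib_left sum_distrib_right by (intro sum.cong refl) auto
  ultimately have sm: "summable (\<lambda>l. pochhammer Z l * D l * r ^ l)" by simp
  then have sm': "summable (\<lambda>l. pochhammer Z (l + Suc N) * D (l + Suc N) * r ^ (l + Suc N))"
    by (rule summable_ignore_initial_segment)
  define B where "B = (\<Sum>l. pochhammer Z (l + Suc N) * D (l + Suc N) * r ^ (l + Suc N))"
  have pZ: "pochhammer Z l \<ge> 0" for l
    using norm_pochhammer_le[of 0 Z l] assms(2) norm_ge_zero[of "pochhammer 0 l :: complex"] by (simp del: norm_ge_zero)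
  have B: "B \<ge> 0" unfolding B_def
    using sm' by (intro suminf_nonneg) (auto intro!: mult_nonneg_nonneg pZ D0 simp: r less_imp_le)
  have "norm (w powr z * rmd N z w) \<le> (B * A ^ Suc N) / norm w ^ Suc N"
    if "norm z \<le> Z" "Re w > 0" "norm w \<ge> A" for z w
  proof -
    have w: "norm w > 0" using that A by linarith
    have q: "0 \<le> A / norm w" "A / norm w \<le> 1" using that A w by auto
    have s: "(\<lambda>l. pochhammer z (l + Suc N) * dcoeff N (l + Suc N) * (1 / w) ^ (l + Suc N)) sums (w powr z * rmd N z w)"
      using that assms by (intro rmd_sums) (auto simp: A_def)
    have le: "norm (pochhammer z l * dcoeff N l * (1 / w) ^ l) \<le> pochhammer Z l * D l * r ^ l * (A / norm w) ^ Suc N"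
      if l: "l \<ge> Suc N" for l
    proof -
      have "norm (1 / w) ^ l = r ^ l * (A / norm w) ^ l"
        using A by (simp add: r_def norm_divide power_divide)
      also have "\<dots> \<le> r ^ l * (A / norm w) ^ Suc N"
        using q r l by (intro mult_left_mono power_decreasing) auto
      finally have "norm (1 / w) ^ l \<le> r ^ l * (A / norm w) ^ Suc N" .
      then have "norm (pochhammer z l) * norm (dcoeff N l) * norm (1 / w) ^ l \<le>
          (pochhammer Z l * D l) * (r ^ l * (A / norm w) ^ Suc N)"
        using norm_pochhammer_le[OF \<open>norm z \<le> Z\<close>, of l] D[of l] pZ D0
        by (intro mult_mono) auto
      then show ?thesis by (simp add: norm_mult norm_power mult_ac)
    qed
    have "norm (\<Sum>l. pochhammer z (l + Suc N) * dcoeff N (l + Suc N) * (1 / w) ^ (l + Suc N)) \<le>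
          (\<Sum>l. pochhammer Z (l + Suc N) * D (l + Suc N) * r ^ (l + Suc N) * (A / norm w) ^ Suc N)"
      by (rule norm_suminf_le[OF le summable_mult2[OF sm']]) auto
    also have "\<dots> = B * (A / norm w) ^ Suc N"
      unfolding B_def by (rule suminf_mult2[OF sm', symmetric])
    finally show ?thesis
      using s by (simp add: sums_iff power_divide del: power_Suc)
  qed
  then show thesis
    using B A by (intro that[of "B * A ^ Suc N"]) (auto simp: A_def)
qed

end

subsection \<open>Lattice sums\<close>

lemma has_sum_finite_sum:
  fixes f :: "'i \<Rightarrow> 'a \<Rightarrow> 'c :: topological_comm_monoid_add"
  assumes "\<And>i. i \<in> I \<Longrightarrow> (f i has_sum s i) A"
  shows "((\<lambda>x. \<Sum>i\<in>I. f i x) has_sum (\<Sum>i\<in>I. s i)) A"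
  using assms by (induction I rule: infinite_finite_induct) (auto intro: has_sum_add)

lemma prod_Suc_le_power:
  fixes n :: "'a \<Rightarrow> nat"
  assumes "finite J"
  shows "(\<Prod>j\<in>J. 1 + n j) \<le> (1 + (\<Sum>j\<in>J. n j)) ^ card J"
proof -
  have "(\<Prod>j\<in>J. 1 + n j) \<le> (\<Prod>j\<in>J. 1 + (\<Sum>j\<in>J. n j))"
    using assms by (intro prod_mono) (auto intro: member_le_sum)
  then show ?thesis by simp
qed

context barnes begin

abbreviation ix :: "(nat \<Rightarrow> nat) set" where
  "ix \<equiv> {1..M} \<rightarrow>\<^sub>E UNIV"

lemma lat_of_real: "lat n = of_real (\<Sum>j=1..M. real (n j) * a j)"
  by (simp add: lat_def)

lemma Re_lat_nonneg: "Re (lat n) \<ge> 0"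
  using pos by (auto simp: lat_of_real less_imp_le intro!: sum_nonneg mult_nonneg_nonneg simp del: of_real_sum)

text \<open>
  The bound \<open>(1 + \<Sum>\<^sub>j n\<^sub>j) ^ M \<ge> \<Prod>\<^sub>j (1 + n\<^sub>j)\<close> reduces the claim to a product of one-dimensional series.
\<close>

lemma summable_norm_lattice_powr:
  assumes w: "Re w > 0" and \<sigma>: "\<sigma> > real M"
  shows "(\<lambda>n. norm (w + lat n) powr (- \<sigma>)) summable_on ix"
proof (cases "M = 0")
  case False
  \<comment> \<open>With this minimum, \<open>norm (w + lat n)\<close> is at least
    \<open>\<delta>\<close> times one plus the sum of the \<open>n j\<close>.\<close>
  define \<delta> where "\<delta> = Min (insert (Re w) (a ` {1..M}))"
  have "\<delta> \<in> insert (Re w) (a ` {1..M})" unfolding \<delta>_def by (rule Min_in) auto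
  then have \<delta>: "\<delta> > 0" using w pos by auto
  have \<delta>w: "\<delta> \<le> Re w" and \<delta>a: "\<And>j. j \<in> {1..M} \<Longrightarrow> \<delta> \<le> a j"
    unfolding \<delta>_def by (intro Min_le; simp)+
  \<comment> \<open>The exponent is shared equally among the \<open>M\<close> coordinates; each
    one-dimensional series converges because the share exceeds 1.\<close>
  define \<tau> where "\<tau> = \<sigma> / M"
  have \<tau>: "\<tau> > 1" using \<sigma> False by (simp add: \<tau>_def)
  have "summable (\<lambda>k. real (Suc k) powr (- \<tau>))"
    using \<tau> summable_real_powr_iff[of "- \<tau>"] by (subst summable_Suc_iff) auto
  then have "(\<lambda>k::nat. norm (real (Suc k) powr (- \<tau>))) summable_on UNIV"
    by (intro norm_summable_imp_summable_on) auto
  then have "(\<lambda>n. norm (\<Prod>j=1..M. real (Suc (n j)) powr (- \<tau>))) summable_on ix"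
    unfolding abs_summable_equivalent by (intro abs_summable_on_prod_PiE) auto
  then have "(\<lambda>n. \<delta> powr (- \<sigma>) * norm (\<Prod>j=1..M. real (Suc (n j)) powr (- \<tau>))) summable_on ix"
    by (rule summable_on_cmult_right)
  then show ?thesis
  proof (rule summable_on_comparison_test)
    fix n assume "n \<in> ix"
    define T where "T = 1 + (\<Sum>j=1..M. n j)"
    have "\<delta> * real T \<le> Re w + (\<Sum>j=1..M. real (n j) * a j)"
    proof -
      have "(\<Sum>j=1..M. \<delta> * real (n j)) \<le> (\<Sum>j=1..M. real (n j) * a j)"
        using \<delta>a by (intro sum_mono, subst mult.commute) (auto intro!: mult_left_mono)
      then show ?thesis using \<delta>w by (simp add: T_def distrib_left sum_distrib_left)
    qed
    also have "\<dots> = Re (w + lat n)" by (simp add: lat_of_real del: of_real_sum)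
    also have "\<dots> \<le> norm (w + lat n)" by (rule complex_Re_le_cmod)
    finally have le: "\<delta> * real T \<le> norm (w + lat n)" .
    have T: "real T \<ge> 1" by (simp add: T_def sum_nonneg)
    have "norm (w + lat n) powr (- \<sigma>) \<le> (\<delta> * real T) powr (- \<sigma>)"
      using le \<delta> T \<sigma> by (intro powr_mono2') auto
    also have "\<dots> = \<delta> powr (- \<sigma>) * real T powr (- \<sigma>)"
      using \<delta> T by (simp add: powr_mult)
    also have "real T powr (- \<sigma>) = real (T ^ M) powr (- \<tau>)"
      using False T by (simp add: \<tau>_def powr_realpow[symmetric] powr_powr)
    also have "\<dots> \<le> real (\<Prod>j=1..M. 1 + n j) powr (- \<tau>)"
    proof (rule powr_mono2')
      show "real (\<Prod>j=1..M. 1 + n j) \<le> real (T ^ M)"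
        using prod_Suc_le_power[of "{1..M}" n] unfolding T_def by (simp only: of_nat_le_iff) simp
      show "0 < real (\<Prod>j=1..M. 1 + n j)"
        by (simp only: of_nat_0_less_iff) (auto intro: prod_pos)
    qed (use \<tau> in auto)
    also have "real (\<Prod>j=1..M. 1 + n j) powr (- \<tau>) = (\<Prod>j=1..M. real (Suc (n j)) powr (- \<tau>))"
      by (subst prod_powr_distrib[symmetric]) auto
    finally show "norm (w + lat n) powr (- \<sigma>) \<le> \<delta> powr (- \<sigma>) * norm (\<Prod>j=1..M. real (Suc (n j)) powr (- \<tau>))"
      using \<delta> by (simp add: mult_left_mono abs_of_nonneg prod_nonneg)
  qed auto
qed auto

lemma summable_lattice_powr:
  assumes w: "Re w > 0" and s: "Re s > real M"
  shows "(\<lambda>n. (w + lat n) powr (- s)) summable_on ix"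
proof (rule abs_summable_summable, rule Infinite_Sum.abs_summable_on_comparison_test')
  show "(\<lambda>n. exp (pi * \<bar>Im s\<bar>) * norm (w + lat n) powr (- Re s)) summable_on ix"
    by (intro summable_on_cmult_right summable_norm_lattice_powr assms)
  fix n
  have "w + lat n \<noteq> 0" using w Re_lat_nonneg[of n] by (auto simp: complex_eq_iff)
  then show "norm ((w + lat n) powr (- s)) \<le> exp (pi * \<bar>Im s\<bar>) * norm (w + lat n) powr (- Re s)"
    using norm_powr_le[of "w + lat n" "- s"] by (simp add: mult.commute)
qed

section \<open>Continuity and decay of the error term\<close>

lemma approx_continuous_on:
  assumes "continuous_on K z" "continuous_on K w" "\<And>x. x \<in> K \<Longrightarrow> Re (w x) > 0"
  shows "continuous_on K (\<lambda>x. approx N (z x) (w x))"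
  unfolding approx_def using assms by (intro continuous_intros) (auto simp: less_imp_le, force)

lemma rmd_continuous_on:
  assumes "continuous_on K z" "continuous_on K w" "\<And>x. x \<in> K \<Longrightarrow> Re (w x) > 0"
  shows "continuous_on K (\<lambda>x. rmd N (z x) (w x))"
  unfolding rmd_def diffop_def using assms
  by (intro continuous_intros approx_continuous_on)
     (auto simp: less_imp_le simp del: of_real_sum intro!: add_pos_nonneg sum_subset(1), force)

text \<open>Far from the origin, the bound is \<open>rmd_bound_large\<close> divided by
  \<open>w powr z\<close>, with \<open>norm_powr_le\<close> controlling the argument. The remaining
  \<open>(z, w)\<close> form a compact set, where continuity suffices.\<close>

lemma rmd_bound:
  assumes "M \<le> N" "Z \<ge> 0" "\<delta> > 0"
  obtains B where "\<And>z w. norm z \<le> Z \<Longrightarrow> Re z \<ge> c \<Longrightarrow> Re w \<ge> \<delta> \<Longrightarrow>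
     norm (rmd N z w) \<le> B * norm w powr (- (c + real (Suc N)))"
proof -
  define A where "A = sum a {1..M} + 1"
  have A: "A \<ge> 1" using sum_subset(1)[of "{1..M}"] by (simp add: A_def)
  obtain B where B: "B \<ge> 0" and le: "\<And>z w. norm z \<le> Z \<Longrightarrow> Re w > 0 \<Longrightarrow> norm w \<ge> A \<Longrightarrow>
     norm (w powr z * rmd N z w) \<le> B / norm w ^ Suc N"
    using rmd_bound_large[OF assms(1,2)] unfolding A_def by blast
  define K where "K = cball (0 :: complex) Z \<times> ({w. Re w \<ge> \<delta>} \<inter> cball 0 A)"
  have "compact ({w. Re w \<ge> \<delta>} \<inter> cball 0 A)"
    using closed_halfspace_Re_ge[of \<delta>] by (intro closed_Int_compact) auto
  then have K: "compact K" unfolding K_def by (intro compact_Times) auto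
  let ?g = "\<lambda>x. norm (rmd N (fst x) (snd x)) * norm (snd x) powr (c + real (Suc N))"
  have "continuous_on K ?g"
    using assms(3) unfolding K_def
    by (intro continuous_intros rmd_continuous_on) auto
  then have "bounded (?g ` K)"
    using K by (intro compact_imp_bounded compact_continuous_image)
  then obtain B' where B': "\<And>x. x \<in> K \<Longrightarrow> norm (?g x) \<le> B'"
    by (auto simp: bounded_iff)
  define B'' where "B'' = max B' (exp (pi * Z) * B)"
  have "norm (rmd N z w) \<le> B'' * norm w powr (- (c + real (Suc N)))"
    if zw: "norm z \<le> Z" "Re z \<ge> c" "Re w \<ge> \<delta>" for z w
  proof -
    have w: "w \<noteq> 0" "Re w > 0" using zw assms by auto
    show ?thesis
    proof (cases "norm w \<le> A")
      case True
      then have "norm (rmd N z w) * norm w powr (c + real (Suc N)) \<le> B'"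
        using B'[of "(z, w)"] zw by (simp add: K_def)
      also have "\<dots> \<le> B''" by (simp add: B''_def)
      finally show ?thesis
        using w by (subst powr_minus) (simp add: field_simps del: of_nat_Suc)
    next
      case False
      then have w1: "norm w \<ge> 1" using A by simp
      have "norm (rmd N z w) = norm (w powr (- z)) * norm (w powr z * rmd N z w)"
        using w by (simp add: norm_mult[symmetric] mult.assoc[symmetric] powr_add[symmetric])
      also have "\<dots> \<le> (norm w powr (- Re z) * exp (pi * \<bar>Im (- z)\<bar>)) * (B / norm w ^ Suc N)"
        using norm_powr_le[of w "- z"] le[of z w] zw w False by (intro mult_mono) auto
      also have "\<dots> \<le> (norm w powr (- c) * exp (pi * Z)) * (B / norm w ^ Suc N)"
        using abs_Im_le_cmod[of z] zw w1 B
        by (intro mult_mono powr_mono) (auto intro: mult_nonneg_nonneg)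
      also have "\<dots> = (exp (pi * Z) * B) * norm w powr (- (c + real (Suc N)))"
        using w by (simp add: powr_diff powr_realpow del: of_nat_Suc power_Suc)
      also have "\<dots> \<le> B'' * norm w powr (- (c + real (Suc N)))"
        by (intro mult_right_mono) (auto simp: B''_def)
      finally show ?thesis .
    qed
  qed
  then show thesis by (rule that)
qed

text \<open>Translation by \<open>sum a S\<close> restricts the sum to lattice points whose
  coordinates in \<open>S\<close> are nonzero. A point \<open>n\<close> then carries the alternating
  sum over all subsets of its support, which vanishes unless \<open>n\<close> is the origin.\<close>

lemma diffop_has_sum:
  assumes "(\<lambda>n. h (w + lat n)) summable_on ix"
  shows "((\<lambda>n. diffop h (w + lat n)) has_sum h w) ix"
proof -
  let ?X = "\<lambda>S. {n \<in> ix. \<forall>j\<in>S. n j \<noteq> 0}"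
  let ?f = "\<lambda>S n. if \<forall>j\<in>S. n j \<noteq> 0 then h (w + lat n) else 0"
  have sm: "(?f S) summable_on ix" for S
  proof -
    have "(\<lambda>n. h (w + lat n)) summable_on ?X S"
      by (rule summable_on_subset_banach[OF assms]) auto
    also have "?this \<longleftrightarrow> (?f S) summable_on ix"
      by (rule summable_on_cong_neutral) auto
    finally show ?thesis .
  qed
  have 2: "(?f S has_sum infsum (?f S) ix) ix" for S
    using sm by (rule has_sum_infsum)
  have 1: "((\<lambda>n. h (w + lat n + of_real (sum a S))) has_sum infsum (?f S) ix) ix"
    if S: "S \<in> Pow {1..M}" for S
  proof -
    let ?i = "\<lambda>n j. if j \<in> S then n j - 1 else n j"
    let ?j = "\<lambda>n j. if j \<in> S then Suc (n j) else n j"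
    have lat: "lat (?j n) = lat n + of_real (sum a S)" for n
    proof -
      have "lat (?j n) = (\<Sum>j=1..M. of_nat (n j) * of_real (a j) + (if j \<in> S then of_real (a j) else 0))"
        unfolding lat_def by (intro sum.cong refl) (auto simp: algebra_simps)
      also have "\<dots> = lat n + of_real (sum a S)"
        using S by (simp add: sum.distrib lat_def sum.If_cases Int_absorb1)
      finally show ?thesis .
    qed
    have inv: "?i (?j n) = n" for n by auto
    have inv': "?j (?i n) = n" if "n \<in> ?X S" for n using that by (auto simp: fun_eq_iff)
    have "bij_betw ?j ix (?X S)"
    proof (rule bij_betw_byWitness[where f' = ?i])
      show "?j ` ix \<subseteq> ?X S" using S by (auto simp: PiE_iff extensional_def)
      show "?i ` ?X S \<subseteq> ix" using S by (auto simp: PiE_iff extensional_def)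
    qed (use inv inv' in blast)+
    then have "((\<lambda>n. h (w + lat (?j n))) has_sum infsum (?f S) ix) ix \<longleftrightarrow>
               ((\<lambda>n. h (w + lat n)) has_sum infsum (?f S) ix) (?X S)"
      by (rule has_sum_reindex_bij_betw)
    also have "\<dots> \<longleftrightarrow> (?f S has_sum infsum (?f S) ix) ix"
      by (rule has_sum_cong_neutral) auto
    finally show ?thesis using 2 by (simp only: lat add.assoc)
  qed
  let ?n0 = "\<lambda>j\<in>{1..M}. 0 :: nat"
  have eq: "(\<Sum>S\<in>Pow {1..M}. (-1) ^ card S * ?f S n) = (if n = ?n0 then h w else 0)"
    if n: "n \<in> ix" for n
  proof -
    let ?J = "{j \<in> {1..M}. n j \<noteq> 0}"
    have "(\<Sum>S\<in>Pow {1..M}. (-1) ^ card S * ?f S n) = (\<Sum>S\<in>Pow ?J. (-1) ^ card S * h (w + lat n))"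
      by (rule sum.mono_neutral_cong_right) auto
    also have "\<dots> = (\<Sum>S\<in>Pow ?J. (-1) ^ card S) * h (w + lat n)"
      by (simp add: sum_distrib_right)
    also have "\<dots> = (if ?J = {} then h (w + lat n) else 0)"
      by (subst sum_Pow_minus_one) auto
    also have "?J = {} \<longleftrightarrow> n = ?n0"
      using n by (auto simp: fun_eq_iff PiE_iff extensional_def)
    also have "(if n = ?n0 then h (w + lat n) else 0) = (if n = ?n0 then h w else 0)"
      by (simp add: lat_def)
    finally show ?thesis .
  qed
  have "((\<lambda>n. \<Sum>S\<in>Pow {1..M}. (-1) ^ card S * ?f S n) has_sum (\<Sum>S\<in>Pow {1..M}. (-1) ^ card S * infsum (?f S) ix)) ix"
    using 2 by (intro has_sum_finite_sum has_sum_cmult_right)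
  also have "?this \<longleftrightarrow> ((\<lambda>n. if n = ?n0 then h w else 0) has_sum (\<Sum>S\<in>Pow {1..M}. (-1) ^ card S * infsum (?f S) ix)) ix"
    by (rule has_sum_cong) (rule eq)
  finally have "((\<lambda>n. if n = ?n0 then h w else 0) has_sum (\<Sum>S\<in>Pow {1..M}. (-1) ^ card S * infsum (?f S) ix)) ix" .
  moreover have "((\<lambda>n. if n = ?n0 then h w else 0) has_sum h w) ix"
    by (rule has_sum_finite_neutralI[of "{?n0}"]) auto
  ultimately have "(\<Sum>S\<in>Pow {1..M}. (-1) ^ card S * infsum (?f S) ix) = h w"
    by (rule has_sum_unique)
  moreover have "((\<lambda>n. diffop h (w + lat n)) has_sum (\<Sum>S\<in>Pow {1..M}. (-1) ^ card S * infsum (?f S) ix)) ix"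
    unfolding diffop_def using 1 by (intro has_sum_finite_sum has_sum_cmult_right)
  ultimately show ?thesis by simp
qed

subsection \<open>Continuation to half-planes\<close>

text \<open>This continues \<open>pochhammer (s - M) M\<close> times the zeta function, which has no
  poles.\<close>

definition partial_cont :: "nat \<Rightarrow> complex \<Rightarrow> complex \<Rightarrow> complex" where
  "partial_cont N w s = approx N (s - of_nat M) w - (\<Sum>\<^sub>\<infinity>n\<in>ix. rmd N (s - of_nat M) (w + lat n))"

lemma Re_add_lat: "Re (w + lat n) \<ge> Re w"
  using Re_lat_nonneg[of n] by simp

lemma approx_holomorphic [holomorphic_intros]:
  "f holomorphic_on S \<Longrightarrow> (\<lambda>s. approx N (f s) w) holomorphic_on S"
  unfolding approx_def by (intro holomorphic_intros)

lemma rmd_holomorphic [holomorphic_intros]: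
  "f holomorphic_on S \<Longrightarrow> (\<lambda>s. rmd N (f s) w) holomorphic_on S"
  unfolding rmd_def diffop_def by (intro holomorphic_intros)

lemma partial_cont_holomorphic:
  assumes N: "M \<le> N" and w: "Re w > 0"
  shows "partial_cont N w holomorphic_on {s. Re s > 2 * real M - real (Suc N)}"
proof -
  let ?S = "{s. Re s > 2 * real M - real (Suc N)}"
  have "(\<lambda>s. \<Sum>\<^sub>\<infinity>n\<in>ix. rmd N (s - of_nat M) (w + lat n)) holomorphic_on ?S"
  proof (rule holomorphic_infsum)
    show "open ?S" by (rule open_halfspace_Re_gt)
    fix s assume s: "s \<in> ?S"
    \<comment> \<open>Half the distance to the boundary line: the decay exponent
      \<open>c + Suc N\<close> then equals \<open>M + r\<close>, still above the threshold
      \<open>M\<close> for lattice sums.\<close>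
    define r where "r = (Re s - (2 * real M - real (Suc N))) / 2"
    have r: "r > 0" using s by (simp add: r_def)
    define c where "c = Re s - r - real M"
    have c: "c + real (Suc N) > real M" using s by (simp add: c_def r_def field_simps)
    define Z where "Z = norm s + r + real M"
    have Z: "Z \<ge> 0" using r by (simp add: Z_def)
    obtain B where B: "\<And>z v. norm z \<le> Z \<Longrightarrow> Re z \<ge> c \<Longrightarrow> Re v \<ge> Re w \<Longrightarrow>
        norm (rmd N z v) \<le> B * norm v powr (- (c + real (Suc N)))"
      using rmd_bound[OF N Z w] by blast
    show "\<exists>r>0. \<exists>g. g summable_on ix \<and>
        (\<forall>n\<in>ix. \<forall>t\<in>?S \<inter> cball s r. norm (rmd N (t - of_nat M) (w + lat n)) \<le> g n)"
    proof (intro exI[of _ r] exI[of _ "\<lambda>n. B * norm (w + lat n) powr (- (c + real (Suc N)))"] conjI ballI)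
      show "(\<lambda>n. B * norm (w + lat n) powr (- (c + real (Suc N)))) summable_on ix"
        by (intro summable_on_cmult_right summable_norm_lattice_powr w c)
      fix n t assume t: "t \<in> ?S \<inter> cball s r"
      then have "norm (s - t) \<le> r" by (simp add: dist_norm)
      moreover have "norm (t - of_nat M) \<le> norm s + norm (s - t) + norm (of_nat M :: complex)"
        using norm_triangle_ineq4[of t "of_nat M"] norm_triangle_ineq4[of s "s - t"] by simp
      moreover have "Re s - Re t \<le> norm (s - t)" using complex_Re_le_cmod[of "s - t"] by simp
      ultimately show "norm (rmd N (t - of_nat M) (w + lat n)) \<le> B * norm (w + lat n) powr (- (c + real (Suc N)))"
        by (intro B Re_add_lat) (auto simp: Z_def c_def)
    qed (rule r)
  qed (intro holomorphic_intros)
  then show ?thesis unfolding partial_cont_def by (intro holomorphic_intros)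
qed

lemma barnes_series_eq: "barnes_series M a s w = (\<Sum>\<^sub>\<infinity>n\<in>ix. (w + lat n) powr (- s))"
  by (simp add: barnes_series_def lat_def)

text \<open>The leading power in \<open>approx\<close> has exponent \<open>M - s\<close>, so
  \<open>Re s > 2 * M\<close> makes its lattice sum converge. Telescoping then applies, and the
  error sum splits into two convergent sums.\<close>

lemma partial_cont_eq_series:
  assumes w: "Re w > 0" and s: "Re s > 2 * real M"
  shows "partial_cont N w s = pochhammer (s - of_nat M) M * barnes_series M a s w"
proof -
  let ?z = "s - of_nat M"
  have "(\<lambda>n. approx N ?z (w + lat n)) summable_on ix"
  proof -
    have "(\<lambda>n. (w + lat n) powr (- (?z + of_nat m))) summable_on ix" for m
      using w s by (intro summable_lattice_powr) auto
    then have "((\<lambda>n. (w + lat n) powr (- (?z + of_nat m))) has_sum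
        (\<Sum>\<^sub>\<infinity>n\<in>ix. (w + lat n) powr (- (?z + of_nat m)))) ix" for m
      by (rule has_sum_infsum)
    then have "((\<lambda>n. \<Sum>m\<le>N. fps_nth bern_fps m * pochhammer ?z m * (w + lat n) powr (- (?z + of_nat m))) has_sum
        (\<Sum>m\<le>N. fps_nth bern_fps m * pochhammer ?z m * (\<Sum>\<^sub>\<infinity>n\<in>ix. (w + lat n) powr (- (?z + of_nat m))))) ix"
      by (intro has_sum_finite_sum has_sum_cmult_right)
    then show ?thesis
      by (auto simp: approx_def summable_on_def)
  qed
  then have 1: "((\<lambda>n. diffop (approx N ?z) (w + lat n)) has_sum approx N ?z w) ix"
    by (rule diffop_has_sum)
  have "(\<lambda>n. (w + lat n) powr (- s)) summable_on ix"
    using w s by (intro summable_lattice_powr) auto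
  then have "((\<lambda>n. - pochhammer ?z M * (w + lat n) powr (- s)) has_sum - pochhammer ?z M * barnes_series M a s w) ix"
    unfolding barnes_series_eq by (intro has_sum_cmult_right has_sum_infsum)
  from has_sum_add[OF 1 this]
  have "((\<lambda>n. rmd N ?z (w + lat n)) has_sum approx N ?z w - pochhammer ?z M * barnes_series M a s w) ix"
    by (simp add: rmd_def)
  then show ?thesis
    by (simp add: partial_cont_def infsumI)
qed

lemma barnes_series_holomorphic:
  assumes w: "Re w > 0"
  shows "(\<lambda>s. barnes_series M a s w) holomorphic_on {s. Re s > real M}"
proof -
  let ?S = "{s. Re s > real M}"
  have w0: "w + lat n \<noteq> 0" for n using w Re_add_lat[of w n] by (auto simp: complex_eq_iff)
  have "(\<lambda>s. \<Sum>\<^sub>\<infinity>n\<in>ix. (w + lat n) powr (- s)) holomorphic_on ?S"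
  proof (rule holomorphic_infsum)
    show "open ?S" by (rule open_halfspace_Re_gt)
    fix s assume s: "s \<in> ?S"
    define r where "r = (Re s - real M) / 2"
    have r: "r > 0" using s by (simp add: r_def)
    define c where "c = Re s - r"
    have c: "c > real M" using s by (simp add: c_def r_def field_simps)
    define Z where "Z = \<bar>Im s\<bar> + r"
    \<comment> \<open>For \<open>t\<close> in the ball, \<open>Re t - c\<close> lies between 0 and
      \<open>2 * r\<close>. The extra factor \<open>norm (w + lat n) powr (- (Re t - c))\<close> is
      at most 1 if the base is at least 1, and otherwise at most
      \<open>Re w powr (- (2 * r))\<close>.\<close>
    let ?D = "max 1 (Re w powr (- (2 * r))) * exp (pi * Z)"
    show "\<exists>r>0. \<exists>g. g summable_on ix \<and>
        (\<forall>n\<in>ix. \<forall>t\<in>?S \<inter> cball s r. norm ((w + lat n) powr (- t)) \<le> g n)"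
    proof (intro exI[of _ r] exI[of _ "\<lambda>n. ?D * norm (w + lat n) powr (- c)"] conjI ballI)
      show "(\<lambda>n. ?D * norm (w + lat n) powr (- c)) summable_on ix"
        by (intro summable_on_cmult_right summable_norm_lattice_powr w c)
      fix n t assume t: "t \<in> ?S \<inter> cball s r"
      then have st: "norm (s - t) \<le> r" by (simp add: dist_norm)
      have Im: "\<bar>Im t\<bar> \<le> Z" using st abs_Im_le_cmod[of "s - t"] by (simp add: Z_def)
      have Re: "c \<le> Re t" "Re t - c \<le> 2 * r" using st abs_Re_le_cmod[of "s - t"] by (simp_all add: c_def)
      let ?x = "norm (w + lat n)"
      have x: "?x > 0" "Re w \<le> ?x" using w0 Re_add_lat[of w n] complex_Re_le_cmod[of "w + lat n"] by (auto simp del: plus_complex.sel)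
      have "?x powr (- (Re t - c)) \<le> max 1 (Re w powr (- (2 * r)))"
      proof (cases "?x \<ge> 1")
        case True
        then have "?x powr (- (Re t - c)) \<le> ?x powr 0" using Re by (intro powr_mono) auto
        then show ?thesis using x by simp
      next
        case False
        then have "?x powr (- (Re t - c)) \<le> ?x powr (- (2 * r))" using x Re by (intro powr_mono') auto
        also have "\<dots> \<le> Re w powr (- (2 * r))" using x w r by (intro powr_mono2') auto
        finally show ?thesis by simp
      qed
      then have "?x powr (- (Re t - c)) * exp (pi * \<bar>Im t\<bar>) * ?x powr (- c) \<le> ?D * ?x powr (- c)"
        using Im by (intro mult_mono) auto
      also have "?x powr (- (Re t - c)) * exp (pi * \<bar>Im t\<bar>) * ?x powr (- c) = ?x powr (- Re t) * exp (pi * \<bar>Im t\<bar>)"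
        using x by (simp add: powr_diff powr_minus field_simps)
      finally show "norm ((w + lat n) powr (- t)) \<le> ?D * ?x powr (- c)"
        using norm_powr_le[OF w0, of n "- t"] by simp
    qed (rule r)
  qed (intro holomorphic_intros)
  then show ?thesis by (simp add: barnes_series_eq)
qed

text \<open>
  At \<open>s = 0\<close> all coefficients \<open>pochhammer (-M) l\<close> of the error series vanish, so the error is zero for
  large \<open>w\<close>, hence everywhere by the identity theorem in \<open>w\<close>.
\<close>

lemma rmd_at_zero:
  assumes N: "M \<le> N" and w: "Re w > 0"
  shows "rmd N (- of_nat M) w = 0"
proof -
  let ?z = "- of_nat M :: complex"
  let ?P = "{w. Re w > 0}" and ?U = "{w. Re w > sum a {1..M}}"
  have A: "sum a {1..M} \<ge> 0" by (rule sum_subset) simp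
  show ?thesis
  proof (rule analytic_continuation_open[of ?U ?P "rmd N ?z" "\<lambda>_. 0"])
    show "open ?U" "open ?P" by (simp_all add: open_halfspace_Re_gt)
    show "connected ?P" by (intro convex_connected convex_halfspace_Re_gt)
    have "of_real (sum a {1..M} + 1) \<in> ?U" by (simp del: of_real_sum of_real_add)
    then show "?U \<noteq> {}" by blast
    show "?U \<subseteq> ?P" using A by auto
    show "w \<in> ?P" using w by simp
    show "rmd N ?z holomorphic_on ?P"
    proof -
      have 1: "w + of_real (sum a S) \<notin> \<real>\<^sub>\<le>\<^sub>0" if "S \<in> Pow {1..M}" "w \<in> ?P" for S w
        using sum_subset(1)[OF that(1)] that(2)
        by (auto simp: complex_nonpos_Reals_iff simp del: of_real_sum)
      have 2: "w \<notin> \<real>\<^sub>\<le>\<^sub>0" if "w \<in> ?P" for w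
        using that by (auto simp: complex_nonpos_Reals_iff)
      show ?thesis
        unfolding rmd_def diffop_def approx_def by (intro holomorphic_intros 1 2)
    qed
    show "rmd N ?z w = 0" if "w \<in> ?U" for w
    proof -
      have w: "Re w > 0" "norm w > sum a {1..M}"
        using that A complex_Re_le_cmod[of w] by auto
      have "pochhammer ?z (l + Suc N) = 0" for l
        using N by (subst pochhammer_eq_0_iff) (auto intro!: exI[of _ M])
      then have "w powr ?z * rmd N ?z w = 0"
        using rmd_sums[OF w N, of ?z] by (simp add: sums_iff)
      then show ?thesis using w by auto
    qed
  qed auto
qed

lemma partial_cont_zero:
  assumes N: "M \<le> N" and w: "Re w > 0"
  shows "partial_cont N w 0 = pochhammer (- of_nat M) M * (multi_bernoulli M M a w / fact M)"
proof -
  let ?z = "- of_nat M :: complex"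
  have w0: "w \<noteq> 0" using w by auto
  have "rmd N ?z (w + lat n) = 0" for n
    using w Re_add_lat[of w n] by (intro rmd_at_zero N) linarith
  then have "partial_cont N w 0 = approx N ?z w" by (simp add: partial_cont_def)
  also have "\<dots> = (\<Sum>m\<le>M. fps_nth bern_fps m * pochhammer ?z m * w powr (of_nat M - of_nat m))"
    \<comment> \<open>Terms with \<open>m > M\<close> vanish because
      \<open>pochhammer (- M) m\<close> contains the factor 0.\<close>
    unfolding approx_def using N
    by (intro sum.mono_neutral_cong_right) (auto simp: pochhammer_of_nat_eq_0_iff)
  also have "\<dots> = (\<Sum>m\<le>M. pochhammer ?z M * (fps_nth bern_fps m * fps_nth (fps_exp (- w)) (M - m)))"
  proof (intro sum.cong refl)
    fix m assume "m \<in> {..M}"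
    then have m: "m \<le> M" by simp
    have "w powr (of_nat M - of_nat m) = w ^ (M - m)"
      using w0 m by (simp add: of_nat_diff[symmetric] powr_nat' del: of_nat_diff)
    moreover have "pochhammer ?z M = pochhammer ?z m * ((-1) ^ (M - m) * fact (M - m))"
    proof -
      have "?z + of_nat m = - of_nat (M - m)" using m by (simp add: of_nat_diff)
      then show ?thesis using pochhammer_product[OF m, of ?z] by (simp only: pochhammer_same)
    qed
    moreover have "(- 1) ^ (M - m) * (- w) ^ (M - m) = w ^ (M - m)"
      by (simp add: power_mult_distrib[symmetric])
    ultimately show "fps_nth bern_fps m * pochhammer ?z m * w powr (of_nat M - of_nat m) =
        pochhammer ?z M * (fps_nth bern_fps m * fps_nth (fps_exp (- w)) (M - m))"
      by simp
  qed
  also have "\<dots> = pochhammer ?z M * (multi_bernoulli M M a w / fact M)"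
    unfolding sum_distrib_left[symmetric] by (simp add: multi_bernoulli_eq) (simp add: fps_mult_nth atMost_atLeast0)
  finally show ?thesis .
qed

end

subsection \<open>Continuation to the whole plane\<close>

text \<open>The identity theorem gives agreement on a punctured neighbourhood of each point. The
  value at the point is then forced: 0 at a pole, the limit otherwise.\<close>

lemma nicely_meromorphic_unique:
  assumes f: "f nicely_meromorphic_on A" and g: "g nicely_meromorphic_on A"
    and A: "open A" "connected A" and U: "open U" "U \<noteq> {}" "U \<subseteq> A"
    and eq: "\<And>z. z \<in> U \<Longrightarrow> f z = g z" and z: "z \<in> A"
  shows "f z = g z"
proof -
  have "(\<lambda>z. f z - g z) meromorphic_on A"
    using f g by (intro meromorphic_intros) (auto simp: nicely_meromorphic_on_def)
  then have "(\<forall>\<^sub>\<approx>z\<in>A. f z - g z = 0) \<or> (\<forall>\<^sub>\<approx>z\<in>A. f z - g z \<noteq> 0)"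
    using A by (rule meromorphic_imp_constant_or_avoid)
  moreover have "\<not> (\<forall>\<^sub>\<approx>z\<in>A. f z - g z \<noteq> 0)"
  proof
    assume "\<forall>\<^sub>\<approx>z\<in>A. f z - g z \<noteq> 0"
    moreover obtain u where u: "u \<in> U" using U by blast
    ultimately have "\<forall>\<^sub>F z in at u. f z - g z \<noteq> 0"
      using U A by (auto simp: eventually_cosparse_open_eq)
    moreover have "\<forall>\<^sub>F z in at u. z \<in> U"
      using U u by (intro eventually_at_in_open') auto
    ultimately have "\<forall>\<^sub>F z in at u. False" by eventually_elim (simp add: eq)
    then show False by simp
  qed
  ultimately have ev: "\<forall>\<^sub>F z in at z. f z = g z"
    using A z by (auto simp: eventually_cosparse_open_eq)
  have "is_pole f z \<longleftrightarrow> is_pole g z" using ev by (rule is_pole_cong) simp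
  moreover have lim: "f \<midarrow>z\<rightarrow> c \<longleftrightarrow> g \<midarrow>z\<rightarrow> c" for c using ev by (rule filterlim_cong[OF refl refl])
  moreover have "is_pole f z \<and> f z = 0 \<or> f \<midarrow>z\<rightarrow> f z" "is_pole g z \<and> g z = 0 \<or> g \<midarrow>z\<rightarrow> g z"
    using f g z by (auto simp: nicely_meromorphic_on_def)
  ultimately show ?thesis
    by (metis LIM_unique not_tendsto_and_filterlim_at_infinity at_neq_bot is_pole_def)
qed

context barnes begin

text \<open>Both sides equal the same multiple of the series for \<open>Re s > 2 * M\<close>; the
  identity theorem extends this to the smaller of the two half-planes.\<close>

lemma partial_cont_consistent:
  assumes w: "Re w > 0" and N: "M \<le> N" "M \<le> N'"
    and s: "Re s > 2 * real M - real (Suc N)" "Re s > 2 * real M - real (Suc N')"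
  shows "partial_cont N w s = partial_cont N' w s"
proof (rule analytic_continuation_open[of "{s. Re s > 2 * real M}"
      "{s. Re s > 2 * real M - real (Suc (min N N'))}" "partial_cont N w" "partial_cont N' w"])
  have "of_real (2 * real M + 1) \<in> {s. Re s > 2 * real M}" by (simp del: of_real_add)
  then show "{s. Re s > 2 * real M} \<noteq> {}" by blast
  show "connected {s. Re s > 2 * real M - real (Suc (min N N'))}"
    by (intro convex_connected convex_halfspace_Re_gt)
  show "partial_cont N w holomorphic_on {s. Re s > 2 * real M - real (Suc (min N N'))}"
    by (rule holomorphic_on_subset[OF partial_cont_holomorphic[OF N(1) w]]) auto
  show "partial_cont N' w holomorphic_on {s. Re s > 2 * real M - real (Suc (min N N'))}"
    by (rule holomorphic_on_subset[OF partial_cont_holomorphic[OF N(2) w]]) auto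
  show "s \<in> {s. Re s > 2 * real M - real (Suc (min N N'))}"
    using s by (auto simp: min_def)
qed (use w in \<open>auto simp: open_halfspace_Re_gt partial_cont_eq_series\<close>)

text \<open>An order \<open>N\<close> whose half-plane of convergence contains \<open>s\<close>.\<close>

definition level :: "complex \<Rightarrow> nat" where
  "level s = 2 * M + nat \<lceil>\<bar>Re s\<bar>\<rceil>"

lemma level: "M \<le> level s" "Re s > 2 * real M - real (Suc (level s))"
proof -
  have "\<bar>Re s\<bar> \<le> real (nat \<lceil>\<bar>Re s\<bar>\<rceil>)" by linarith
  then show "Re s > 2 * real M - real (Suc (level s))"
    by (simp only: level_def of_nat_Suc of_nat_add of_nat_mult of_nat_numeral)
qed (simp add: level_def)

text \<open>The entire function \<open>(s - 1) ... (s - M)\<close> times zeta. The order varies with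
  \<open>s\<close>, but by consistency it can be frozen near any given point.\<close>

definition cont :: "complex \<Rightarrow> complex \<Rightarrow> complex" where
  "cont w s = partial_cont (level s) w s"

lemma cont_holomorphic:
  assumes w: "Re w > 0"
  shows "cont w holomorphic_on UNIV"
proof -
  have "cont w analytic_on {s}" for s
  proof -
    let ?H = "{t. Re t > 2 * real M - real (Suc (level s))}"
    have "cont w t = partial_cont (level s) w t" if "t \<in> ?H" for t
      unfolding cont_def using that level[of t] level[of s] w
      by (intro partial_cont_consistent) auto
    then have "cont w holomorphic_on ?H"
      using holomorphic_transform[OF partial_cont_holomorphic[OF level(1) w, of s]] by simp
    moreover have "open ?H" "s \<in> ?H" using level(2) by (auto simp: open_halfspace_Re_gt)
    ultimately show ?thesis by (auto simp: analytic_at)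
  qed
  then show ?thesis
    by (metis analytic_imp_holomorphic analytic_on_analytic_at)
qed

text \<open>Telescoping gave this only for \<open>Re s > 2 * M\<close>; holomorphy of the series
  itself carries it to the full half-plane of convergence.\<close>

lemma cont_eq_series:
  assumes w: "Re w > 0" and s: "Re s > real M"
  shows "cont w s = pochhammer (s - of_nat M) M * barnes_series M a s w"
proof (rule analytic_continuation_open[of "{s. Re s > 2 * real M}" "{s. Re s > real M}"
      "cont w" "\<lambda>s. pochhammer (s - of_nat M) M * barnes_series M a s w"])
  have "of_real (2 * real M + 1) \<in> {s. Re s > 2 * real M}" by (simp del: of_real_add)
  then show "{s. Re s > 2 * real M} \<noteq> {}" by blast
  show "connected {s. Re s > real M}"
    by (intro convex_connected convex_halfspace_Re_gt)
  show "cont w holomorphic_on {s. Re s > real M}"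
    using cont_holomorphic[OF w] by (rule holomorphic_on_subset) auto
  show "(\<lambda>s. pochhammer (s - of_nat M) M * barnes_series M a s w) holomorphic_on {s. Re s > real M}"
    by (intro holomorphic_intros barnes_series_holomorphic w)
qed (use w s in \<open>auto simp: open_halfspace_Re_gt cont_def partial_cont_eq_series\<close>)

section \<open>Identification with the Barnes zeta function near 0\<close>

lemma pochhammer_shift_eq_0_iff:
  "pochhammer (s - of_nat M) M = (0 :: complex) \<longleftrightarrow> s \<in> of_nat ` {1..M}"
proof
  assume "pochhammer (s - of_nat M) M = 0"
  then obtain k where "k < M" "s - of_nat M = - of_nat k" by (auto simp: pochhammer_eq_0_iff)
  then show "s \<in> of_nat ` {1..M}"
    by (intro image_eqI[of _ _ "M - k"]) (auto simp: of_nat_diff algebra_simps)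
next
  assume "s \<in> of_nat ` {1..M}"
  then obtain i where "i \<in> {1..M}" "s = of_nat i" by blast
  then show "pochhammer (s - of_nat M) M = 0"
    by (auto simp: pochhammer_eq_0_iff of_nat_diff intro!: exI[of _ "M - i"])
qed

lemma barnes_zeta_eq:
  assumes w: "Re w > 0" and s: "pochhammer (s - of_nat M) M \<noteq> 0"
  shows "barnes_zeta M a s w = cont w s / pochhammer (s - of_nat M) M"
proof -
  let ?Q = "\<lambda>s :: complex. pochhammer (s - of_nat M) M"
  \<comment> \<open>Dividing by zeros of \<open>?Q\<close> may leave poles or removable
    singularities; \<open>remove_sings\<close> normalizes both as the definite description in
    \<open>barnes_zeta\<close> demands.\<close>
  define f where "f = remove_sings (\<lambda>s. cont w s / ?Q s)"
  have an: "cont w analytic_on X" "?Q analytic_on X" for X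
  proof -
    show "cont w analytic_on X" using cont_holomorphic[OF w] by (meson analytic_on_open analytic_on_subset open_UNIV subset_UNIV)
    have "?Q holomorphic_on UNIV" by (intro holomorphic_intros)
    then show "?Q analytic_on X" by (meson analytic_on_open analytic_on_subset open_UNIV subset_UNIV)
  qed
  have mero: "f nicely_meromorphic_on UNIV"
    unfolding f_def using an
    by (intro remove_sings_nicely_meromorphic meromorphic_on_divide analytic_on_imp_meromorphic_on)
  have val: "f t = cont w t / ?Q t" if "?Q t \<noteq> 0" for t
    unfolding f_def using that an by (intro remove_sings_at_analytic analytic_on_divide) auto
  have ser: "f t = barnes_series M a t w" if t: "Re t > real M" for t
  proof -
    have "?Q t \<noteq> 0" using t by (auto simp: pochhammer_shift_eq_0_iff)
    then show ?thesis using val cont_eq_series[OF w t] by simp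
  qed
  have uniq: "g = f" if "g nicely_meromorphic_on UNIV" "\<forall>t. Re t > real M \<longrightarrow> g t = barnes_series M a t w" for g
  proof
    fix t
    have "of_real (real M + 1) \<in> {s. Re s > real M}" by (simp del: of_real_add)
    then have ne: "{s. Re s > real M} \<noteq> {}" by blast
    show "g t = f t"
      by (rule nicely_meromorphic_unique[OF that(1) mero _ _ _ ne])
         (use that ser in \<open>auto simp: open_halfspace_Re_gt\<close>)
  qed
  have "(THE f. f nicely_meromorphic_on UNIV \<and> (\<forall>z. Re z > real M \<longrightarrow> f z = barnes_series M a z w)) = f"
    by (rule the_equality) (use mero ser uniq in blast)+
  then show ?thesis unfolding barnes_zeta_def using val[OF s] by simp
qed

lemma pochhammer_zero_neq: "pochhammer (- of_nat M) M \<noteq> (0 :: complex)"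
  by (simp add: pochhammer_of_nat_eq_0_iff)

lemma barnes_zeta_zero:
  assumes w: "Re w > 0"
  shows "barnes_zeta M a 0 w = multi_bernoulli M M a w / fact M"
  using barnes_zeta_eq[OF w, of 0] pochhammer_zero_neq partial_cont_zero[OF level(1) w, of 0]
  by (simp add: cont_def)

lemma eventually_pochhammer_neq:
  "\<forall>\<^sub>F s in nhds 0. pochhammer (s - of_nat M) M \<noteq> (0 :: complex)"
proof -
  have "continuous_on UNIV (\<lambda>s :: complex. pochhammer (s - of_nat M) M)" by (intro continuous_intros)
  then have "open {s :: complex. pochhammer (s - of_nat M) M \<noteq> 0}"
    by (intro open_Collect_neq continuous_intros)
  then show ?thesis using pochhammer_zero_neq by (intro eventually_nhds_in_open[of "{s. pochhammer (s - of_nat M) M \<noteq> 0}", simplified mem_Collect_eq]) auto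
qed

lemma barnes_zeta_differentiable:
  assumes w: "Re w > 0"
  shows "(\<lambda>s. barnes_zeta M a s w) field_differentiable (at 0)"
proof -
  have "(\<lambda>s. cont w s / pochhammer (s - of_nat M) M) holomorphic_on {s. pochhammer (s - of_nat M) M \<noteq> 0}"
    using cont_holomorphic[OF w] by (auto intro!: holomorphic_intros elim: holomorphic_on_subset)
  moreover have "open {s :: complex. pochhammer (s - of_nat M) M \<noteq> 0}"
    by (intro open_Collect_neq continuous_intros)
  ultimately have D: "((\<lambda>s. cont w s / pochhammer (s - of_nat M) M) has_field_derivative
      deriv (\<lambda>s. cont w s / pochhammer (s - of_nat M) M) 0) (at 0)"
    by (rule holomorphic_derivI) (simp add: pochhammer_zero_neq)
  have "\<forall>\<^sub>F s in nhds 0. barnes_zeta M a s w = cont w s / pochhammer (s - of_nat M) M"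
    using eventually_pochhammer_neq by eventually_elim (rule barnes_zeta_eq[OF w])
  from DERIV_cong_ev[OF refl this refl] D show ?thesis
    unfolding field_differentiable_def by blast
qed

subsection \<open>The multiplication formula\<close>

lemma lat_combine:
  assumes "k \<ge> 1"
  shows "of_nat k * w + lat (\<lambda>j\<in>{1..M}. k * m j + p j) = of_nat k * (w + lat p / of_nat k + lat m)"
proof -
  have "lat (\<lambda>j\<in>{1..M}. k * m j + p j) = of_nat k * lat m + lat p"
    by (simp add: lat_def sum.distrib sum_distrib_left algebra_simps)
  then show ?thesis using assms by (simp add: field_simps)
qed

lemma Re_shift:
  assumes "Re w > 0"
  shows "Re (w + lat p / of_nat k) > 0"
  using assms Re_lat_nonneg[of p] by (auto simp: Re_divide_of_nat intro!: add_pos_nonneg)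

lemma powr_of_nat_mult:
  assumes "k \<ge> 1" "Re v > 0"
  shows "(of_nat k * v) powr s = of_nat k powr s * (v :: complex) powr s"
proof -
  have v: "v \<noteq> 0" using assms by auto
  then have "Ln (of_real (real k) * v) = of_real (ln (real k)) + Ln v"
    using assms by (subst Ln_times_of_real) auto
  then show ?thesis
    using assms v by (simp add: powr_def distrib_left exp_add Ln_of_nat)
qed

lemma barnes_series_multiplication:
  assumes w: "Re w > 0" and k: "k \<ge> 1" and s: "Re s > real M"
  shows "barnes_series M a s (of_nat k * w) =
    of_nat k powr (- s) * (\<Sum>p\<in>{1..M} \<rightarrow>\<^sub>E {0..k-1}. barnes_series M a s (w + lat p / of_nat k))"
proof -
  let ?P = "{1..M} \<rightarrow>\<^sub>E {0..k-1}"
  \<comment> \<open>Coordinatewise division by \<open>k\<close>: \<open>p\<close> collects the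
    remainders and \<open>m\<close> the quotients. The restrictions keep the functions extensional,
    as \<open>PiE\<close> requires.\<close>
  let ?\<phi> = "\<lambda>(p, m). \<lambda>j\<in>{1..M}. k * m j + p j :: nat"
  let ?\<psi> = "\<lambda>n. (\<lambda>j\<in>{1..M}. n j mod k, \<lambda>j\<in>{1..M}. n j div k)"
  let ?f = "\<lambda>n. (of_nat k * w + lat n) powr (- s)"
  have small: "p j < k" if "p \<in> ?P" "j \<in> {1..M}" for p j
    using PiE_mem[OF that] k by auto
  have left: "?\<psi> (?\<phi> (p, m)) = (p, m)" if p: "p \<in> ?P" and m: "m \<in> ix" for p m
  proof -
    have "(k * m j + p j) mod k = p j" "(k * m j + p j) div k = m j" if "j \<in> {1..M}" for j
      using small[OF p that] by simp_all
    then have "?\<psi> (?\<phi> (p, m)) = (restrict p {1..M}, restrict m {1..M})"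
      by (simp cong: restrict_cong)
    then show ?thesis using p m by (simp only: PiE_restrict)
  qed
  have right: "?\<phi> (?\<psi> n) = n" if n: "n \<in> ix" for n
  proof -
    have "?\<phi> (?\<psi> n) = restrict n {1..M}" by (simp cong: restrict_cong)
    then show ?thesis using n by (simp only: PiE_restrict)
  qed
  have bij: "bij_betw ?\<phi> (?P \<times> ix) ix"
  proof (rule bij_betw_byWitness[where f' = ?\<psi>])
    show "\<forall>x\<in>?P \<times> ix. ?\<psi> (?\<phi> x) = x" using left by blast
    show "\<forall>n\<in>ix. ?\<phi> (?\<psi> n) = n" using right by blast
    have "x mod k \<in> {0..k-1}" for x
      using k mod_less_divisor[of k x] by (simp add: less_eq_Suc_le)
    then show "?\<psi> ` ix \<subseteq> ?P \<times> ix" by (intro subsetI) (clarsimp simp only: image_iff mem_Times_iff fst_conv snd_conv restrict_PiE_iff UNIV_I simp_thms)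
    show "?\<phi> ` (?P \<times> ix) \<subseteq> ix"
      by (intro subsetI) (clarsimp simp only: image_iff mem_Times_iff prod.case restrict_PiE_iff UNIV_I simp_thms)
  qed
  have Re: "Re (of_nat k * w) > 0" using w k by simp
  have "?f summable_on ix" by (rule summable_lattice_powr[OF Re s])
  then have sm: "(\<lambda>x. ?f (?\<phi> x)) summable_on ?P \<times> ix"
    by (subst summable_on_reindex_bij_betw[OF bij])
  have f: "?f (?\<phi> (p, m)) = of_nat k powr (- s) * (w + lat p / of_nat k + lat m) powr (- s)" for p m
  proof -
    have "Re (w + lat p / of_nat k + lat m) > 0"
      using Re_add_lat[of "w + lat p / of_nat k" m] Re_shift[OF w, of p k] by linarith
    then show ?thesis using k by (simp only: prod.case lat_combine powr_of_nat_mult)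
  qed
  have "infsum ?f ix = infsum (\<lambda>x. ?f (?\<phi> x)) (?P \<times> ix)"
    by (rule infsum_reindex_bij_betw[OF bij, symmetric])
  also have "\<dots> = (\<Sum>\<^sub>\<infinity>p\<in>?P. \<Sum>\<^sub>\<infinity>m\<in>ix. ?f (?\<phi> (p, m)))"
    by (rule infsum_Sigma_banach[OF sm, symmetric])
  also have "\<dots> = (\<Sum>p\<in>?P. \<Sum>\<^sub>\<infinity>m\<in>ix. ?f (?\<phi> (p, m)))"
    by (intro infsum_finite finite_PiE) auto
  also have "\<dots> = of_nat k powr (- s) * (\<Sum>p\<in>?P. \<Sum>\<^sub>\<infinity>m\<in>ix. (w + lat p / of_nat k + lat m) powr (- s))"
    unfolding f sum_distrib_left by (intro sum.cong refl infsum_cmult_right')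
  finally show ?thesis by (simp only: barnes_series_eq)
qed

text \<open>All terms carry the same factor \<open>pochhammer (s - M) M\<close>, so both sides are
  entire and the identity theorem applies on the whole plane.\<close>

lemma cont_multiplication:
  assumes w: "Re w > 0" and k: "k \<ge> 1"
  shows "cont (of_nat k * w) s =
    of_nat k powr (- s) * (\<Sum>p\<in>{1..M} \<rightarrow>\<^sub>E {0..k-1}. cont (w + lat p / of_nat k) s)"
proof (rule analytic_continuation_open[of "{s. Re s > real M}" UNIV "cont (of_nat k * w)"
      "\<lambda>s. of_nat k powr (- s) * (\<Sum>p\<in>{1..M} \<rightarrow>\<^sub>E {0..k-1}. cont (w + lat p / of_nat k) s)"])
  have "of_real (real M + 1) \<in> {s. Re s > real M}" by (simp del: of_real_add)
  then show "{s. Re s > real M} \<noteq> {}" by blast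
  show "cont (of_nat k * w) holomorphic_on UNIV"
    using w k by (intro cont_holomorphic) auto
  show "(\<lambda>s. of_nat k powr (- s) * (\<Sum>p\<in>{1..M} \<rightarrow>\<^sub>E {0..k-1}. cont (w + lat p / of_nat k) s)) holomorphic_on UNIV"
    using cont_holomorphic[OF Re_shift[OF w]] by (intro holomorphic_intros) auto
  fix s assume "s \<in> {s. Re s > real M}"
  then have s: "Re s > real M" by simp
  have "Re (of_nat k * w) > 0" using w k by simp
  then show "cont (of_nat k * w) s =
    of_nat k powr (- s) * (\<Sum>p\<in>{1..M} \<rightarrow>\<^sub>E {0..k-1}. cont (w + lat p / of_nat k) s)"
    using barnes_series_multiplication[OF w k s] cont_eq_series[OF _ s] Re_shift[OF w]
    by (simp add: sum_distrib_left mult_ac)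
qed (auto simp: open_halfspace_Re_gt)

lemma barnes_zeta_multiplication:
  assumes w: "Re w > 0" and k: "k \<ge> 1" and s: "pochhammer (s - of_nat M) M \<noteq> 0"
  shows "barnes_zeta M a s (of_nat k * w) =
    of_nat k powr (- s) * (\<Sum>p\<in>{1..M} \<rightarrow>\<^sub>E {0..k-1}. barnes_zeta M a s (w + lat p / of_nat k))"
proof -
  have "Re (of_nat k * w) > 0" using w k by simp
  then show ?thesis
    using cont_multiplication[OF w k, of s] barnes_zeta_eq[OF _ s] Re_shift[OF w] s
    by (simp add: sum_divide_distrib[symmetric])
qed

section \<open>Differentiation at s = 0\<close>

lemma barnes_L_multiplication:
  assumes w: "Re w > 0" and k: "k \<ge> 1"
  shows "barnes_L M a (of_nat k * w) =
    - of_real (ln (real k)) * (multi_bernoulli M M a (of_nat k * w) / fact M) +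
    (\<Sum>p\<in>{1..M} \<rightarrow>\<^sub>E {0..k-1}. barnes_L M a (w + lat p / of_nat k))"
proof -
  let ?P = "{1..M} \<rightarrow>\<^sub>E {0..k-1}"
  let ?G = "\<lambda>s. \<Sum>p\<in>?P. barnes_zeta M a s (w + lat p / of_nat k)"
  have kw: "Re (of_nat k * w) > 0" using w k by simp
  \<comment> \<open>At \<open>s = 0\<close> the power of \<open>k\<close> is 1, so the sum over
    \<open>p\<close> collapses to the single zeta value at \<open>k * w\<close>. This is why the
    exponent contains one Bernoulli polynomial at \<open>k * w\<close>.\<close>
  have G0: "?G 0 = multi_bernoulli M M a (of_nat k * w) / fact M"
    using barnes_zeta_multiplication[OF w k, of 0] barnes_zeta_zero[OF kw] pochhammer_zero_neq k by simp
  have "((\<lambda>s. barnes_zeta M a s (w + lat p / of_nat k)) has_field_derivative barnes_L M a (w + lat p / of_nat k)) (at 0)" for p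
    unfolding barnes_L_def using barnes_zeta_differentiable[OF Re_shift[OF w]]
    by (simp add: DERIV_deriv_iff_field_differentiable)
  then have G: "(?G has_field_derivative (\<Sum>p\<in>?P. barnes_L M a (w + lat p / of_nat k))) (at 0)"
    by (intro DERIV_sum)
  have "((\<lambda>s. exp (- s * of_real (ln (real k)))) has_field_derivative - of_real (ln (real k))) (at 0)"
    by (auto intro!: derivative_eq_intros)
  from DERIV_mult[OF this G]
  have D: "((\<lambda>s. exp (- s * of_real (ln (real k))) * ?G s) has_field_derivative
     - of_real (ln (real k)) * ?G 0 + (\<Sum>p\<in>?P. barnes_L M a (w + lat p / of_nat k))) (at 0)"
    by (simp add: algebra_simps)
  have "\<forall>\<^sub>F s in nhds 0. barnes_zeta M a s (of_nat k * w) = exp (- s * of_real (ln (real k))) * ?G s"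
    using eventually_pochhammer_neq
    by eventually_elim (use k in \<open>simp add: barnes_zeta_multiplication[OF w k] powr_def Ln_of_nat\<close>)
  then have "deriv (\<lambda>s. barnes_zeta M a s (of_nat k * w)) 0 = deriv (\<lambda>s. exp (- s * of_real (ln (real k))) * ?G s) 0"
    by (intro deriv_cong_ev) auto
  then show ?thesis
    using DERIV_imp_deriv[OF D] G0 by (simp add: barnes_L_def)
qed

end

theorem theorem2p4:
  fixes M k :: nat and a :: "nat \<Rightarrow> real" and w :: complex
  assumes "\<And>j. j \<in> {1..M} \<Longrightarrow> a j > 0"
    and "Re w > 0"
    and "k \<ge> 1"
  shows "barnes_Gamma M a (of_nat k * w) =
           of_nat k powr (- multi_bernoulli M M a (of_nat k * w) / fact M) *
           (\<Prod>p\<in>({1..M} \<rightarrow>\<^sub>E {0..k-1}).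
              barnes_Gamma M a (w + (\<Sum>j=1..M. of_nat (p j) * of_real (a j)) / of_nat k))"
proof -
  interpret barnes M a by unfold_locales (rule assms(1))
  show ?thesis
  proof (cases "M = 0")
    \<comment> \<open>Here \<open>barnes_Gamma\<close> is \<open>1 / w\<close>, the product has one
      factor, and the Bernoulli polynomial is 1, so the claim is
      \<open>1 / (k * w) = (1 / k) * (1 / w)\<close>.\<close>
    case True
    have "bern_fps = 1" unfolding bern_fps_def by (simp add: True)
    then have "multi_bernoulli M M a (of_nat k * w) = 1"
      unfolding multi_bernoulli_eq by (simp add: True)
    then show ?thesis
      using True assms by (simp add: barnes_Gamma_def powr_minus field_simps)
  next
    case False
    let ?P = "{1..M} \<rightarrow>\<^sub>E {0..k-1}"
    have fin: "finite ?P" by (intro finite_PiE) auto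
    have k: "of_nat k powr z = exp (z * of_real (ln (real k)))" for z :: complex
      using assms(3) by (simp add: powr_def Ln_of_nat)
    have "barnes_Gamma M a (of_nat k * w) =
        exp (- of_real (ln (real k)) * (multi_bernoulli M M a (of_nat k * w) / fact M)) *
        exp (\<Sum>p\<in>?P. barnes_L M a (w + lat p / of_nat k))"
      using False unfolding barnes_Gamma_def exp_add[symmetric]
      by (simp only: barnes_L_multiplication[OF assms(2,3)] if_False)
    also have "\<dots> = of_nat k powr (- multi_bernoulli M M a (of_nat k * w) / fact M) *
        (\<Prod>p\<in>?P. barnes_Gamma M a (w + lat p / of_nat k))"
      using False unfolding exp_sum[OF fin] k by (simp add: barnes_Gamma_def mult.commute)
    finally show ?thesis by (simp only: lat_def)
  qed
qed

end
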